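(* Let $n\ge2$ and let $K$ be a convex body in $\mathbb{R}^n$. The function $e_K$ is upper semicontinuous on $\mathbb{R}^n$, and its restrictions to the interior $K^\circ$ of $K$ and to $\mathbb{R}^n\setminus K$ are continuous.
   Context: A convex body in $\mathbb{R}^n$ is a compact convex set with nonempty interior. For $O\in\mathbb{R}^n$, $e_K(O)$ is the diameter of $K$ with respect to $O$, i.e. the maximal length of a chord $L\cap K$ of $K$ cut by a line $L$ through $O$. *)

theory Defs
  imports "HOL-Analysis.Analysis"
begin

definition convex_body :: "'a::euclidean_space set \<Rightarrow> bool" where
  "convex_body K \<longleftrightarrow> compact K \<and> convex K \<and> interior K \<noteq> {}"

definition lines_through :: "'a::euclidean_space \<Rightarrow> 'a set set" where
  "lines_through p = {L. affine L \<and> aff_dim L = 1 \<and> p \<in> L}"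

(* For convex compact K the chord L \<inter> K is a segment, so its length is its diameter.
   A line missing K, or meeting it in a single point, contributes length 0.  The supremum
   is a maximum for compact K, see chord_diam_attained below. *)
definition chord_diam :: "'a::euclidean_space set \<Rightarrow> 'a \<Rightarrow> real" where
  "chord_diam K p = (SUP L\<in>lines_through p. diameter (L \<inter> K))"

definition upper_semicontinuous_on :: "'a::topological_space set \<Rightarrow> ('a \<Rightarrow> real) \<Rightarrow> bool" where
  "upper_semicontinuous_on S f \<longleftrightarrow>
     (\<forall>x\<in>S. \<forall>c>f x. eventually (\<lambda>y. f y < c) (at x within S))"

lemma chord_diam_attained:
  fixes K :: "'a::euclidean_space set"
  assumes "compact K"
  shows "\<exists>L\<in>lines_through p. chord_diam K p = diameter (L \<inter> K) \<and>
           (\<forall>M\<in>lines_through p. diameter (M \<inter> K) \<le> diameter (L \<inter> K))"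
proof -
  have line: "\<exists>L\<in>lines_through p. {p, a, b} \<subseteq> L" if col: "collinear {p, a, b}" for a b
  proof -
    obtain u where u: "u \<noteq> 0" "\<forall>x\<in>{p, a, b}. \<forall>y\<in>{p, a, b}. \<exists>c. x - y = c *\<^sub>R u"
      using col unfolding collinear by blast
    let ?L = "affine hull {p, p + u}"
    have "x \<in> ?L" if x: "x \<in> {p, a, b}" for x
    proof -
      obtain c where "x - p = c *\<^sub>R u" using u(2) x by (metis insertI1)
      then have "x = (1 - c) *\<^sub>R p + c *\<^sub>R (p + u)" by (simp add: algebra_simps)
      moreover have "(1 - c) + c = 1" by simp
      ultimately show ?thesis unfolding affine_hull_2 by blast
    qed
    moreover have "?L \<in> lines_through p"
      using u(1) by (simp add: lines_through_def aff_dim_affine_hull aff_dim_2 hull_inc)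
    ultimately show ?thesis by blast
  qed
  have bound: "dist x y \<le> diameter (L \<inter> K)" if "x \<in> L \<inter> K" "y \<in> L \<inter> K" for x y L
    proof -
    have "bounded (L \<inter> K)" using assms by (simp add: bounded_Int compact_imp_bounded)
    then show ?thesis using that by (rule diameter_bounded_bound)
  qed
  have "\<exists>L\<in>lines_through p. \<forall>M\<in>lines_through p. diameter (M \<inter> K) \<le> diameter (L \<inter> K)"
  proof (cases "K = {}")
    case True
    then show ?thesis using line[of p p] by auto
  next
    case False
    let ?C = "(K \<times> K) \<inter> {z. collinear {p, fst z, snd z}}"
    have eq: "collinear {p, x, y} \<longleftrightarrow> \<bar>(x - p) \<bullet> (y - p)\<bar> = norm (x - p) * norm (y - p)" for x y
    proof -
      have "collinear {p, x, y} \<longleftrightarrow> collinear {x, p, y}" by (simp add: insert_commute)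
      also have "\<dots> \<longleftrightarrow> collinear {0, x - p, y - p}" by (rule collinear_3) (simp add: NO_MATCH_def)
      finally show ?thesis by (simp add: norm_cauchy_schwarz_equal)
    qed
    have "closed {z. collinear {p, fst z, snd z}}"
      unfolding eq by (intro closed_Collect_eq continuous_intros)
    then have "compact ?C" using assms by (intro compact_Int_closed compact_Times)
    moreover obtain k where "k \<in> K" using False by blast
    then have "(k, k) \<in> ?C" by (simp add: insert_commute)
    then have "?C \<noteq> {}" by blast
    ultimately have "\<exists>z\<in>?C. \<forall>w\<in>?C. dist (fst w) (snd w) \<le> dist (fst z) (snd z)"
      by (intro continuous_attains_sup continuous_intros)
    then obtain z where z: "z \<in> ?C"
      and zmax: "\<forall>w\<in>?C. dist (fst w) (snd w) \<le> dist (fst z) (snd z)" ..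
    define a b where "a = fst z" and "b = snd z"
    have ab: "a \<in> K" "b \<in> K" "collinear {p, a, b}"
      using z by (auto simp: a_def b_def)
    have mx: "dist x y \<le> dist a b" if "x \<in> K" "y \<in> K" "collinear {p, x, y}" for x y
      using bspec[OF zmax, of "(x, y)"] that by (simp add: a_def b_def)
    obtain L where L: "L \<in> lines_through p" "{p, a, b} \<subseteq> L" using line[OF ab(3)] by blast
    have "diameter (M \<inter> K) \<le> dist a b" if M: "M \<in> lines_through p" for M
    proof (rule diameter_le)
      show "M \<inter> K \<noteq> {} \<or> 0 \<le> dist a b" by simp
      fix x y assume xy: "x \<in> M \<inter> K" "y \<in> M \<inter> K"
      have "collinear M" using M by (simp add: lines_through_def collinear_aff_dim)
      then have "collinear {p, x, y}"
        by (rule collinear_subset) (use xy M in \<open>auto simp: lines_through_def\<close>)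
      then show "norm (x - y) \<le> dist a b" using mx xy by (simp add: dist_norm)
    qed
    moreover have "dist a b \<le> diameter (L \<inter> K)" using bound L ab by blast
    ultimately show ?thesis using L(1) by (meson order_trans)
  qed
  then obtain L where L: "L \<in> lines_through p"
    "\<And>M. M \<in> lines_through p \<Longrightarrow> diameter (M \<inter> K) \<le> diameter (L \<inter> K)" by blast
  then have "chord_diam K p = diameter (L \<inter> K)"
    unfolding chord_diam_def by (intro cSup_eq_maximum) auto
  with L show ?thesis by blast
qed

end

theory Submission
  imports Defs
begin

text \<open>
  Upper semicontinuity is compactness: the superlevel sets of \<^term>\<open>chord_diam K\<close> are projections
  of closed sets along the compact \<^term>\<open>K \<times> K\<close>. For lower semicontinuity at a point \<open>p\<close> off the
  boundary, the endpoints of a longest chord through \<open>p\<close> are moved slightly into the interior of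
  \<open>K\<close> while staying collinear with \<open>p\<close>; the perturbed chord can then be translated along with \<open>p\<close>.
  If \<open>p\<close> is interior, the chord is contracted towards \<open>p\<close>. If \<open>p\<close> lies outside \<open>K\<close>, the two
  endpoints are moved towards an interior point at different speeds, which is possible because
  they lie on the same side of \<open>p\<close>.
\<close>

text \<open>Vectors based at \<open>p\<close> make the effect of scaling about \<open>p\<close> and
  of common translations visible, and give access to the equality case of Cauchy-Schwarz.\<close>

lemma collinear_3_diff:
  "collinear {p, x, y :: 'a::euclidean_space} \<longleftrightarrow> collinear {0, x - p, y - p}"
proof -
  have "collinear {p, x, y} \<longleftrightarrow> collinear {x, p, y}" by (simp add: insert_commute)
  also have "\<dots> \<longleftrightarrow> collinear {0, x - p, y - p}"
    by (rule collinear_3) (simp add: NO_MATCH_def)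
  finally show ?thesis .
qed

lemma dist_le_chord_diam:
  fixes K :: "'a::euclidean_space set"
  assumes K: "compact K" and xy: "x \<in> K" "y \<in> K" and col: "collinear {p, x, y}"
  shows "dist x y \<le> chord_diam K p"
proof -
  have diam: "diameter (L \<inter> K) \<le> chord_diam K p" if "L \<in> lines_through p" for L
    using chord_diam_attained[OF K] that by metis
  have bdd: "bounded (L \<inter> K)" for L
    using K by (simp add: bounded_Int compact_imp_bounded)
  show ?thesis
  proof (cases "x = y")
    case True
    \<comment> \<open>Here \<open>affine hull {x, y}\<close> is a point; any line through
      \<open>p\<close> serves instead, as diameters are nonnegative.\<close>
    obtain L where "L \<in> lines_through p" using chord_diam_attained[OF K] by blast
    then show ?thesis using True diam diameter_ge_0[OF bdd] by (metis dist_self order_trans)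
  next
    case False
    let ?L = "affine hull {x, y}"
    have "p \<in> ?L"
      using col False collinear_3_affine_hull by (metis insert_commute)
    then have "?L \<in> lines_through p"
      using False by (simp add: lines_through_def aff_dim_2)
    moreover have "dist x y \<le> diameter (?L \<inter> K)"
      using xy by (intro diameter_bounded_bound bdd) (auto simp: hull_inc)
    ultimately show ?thesis using diam by (meson order_trans)
  qed
qed

lemma chord_diam_endpoints:
  fixes K :: "'a::euclidean_space set"
  assumes K: "compact K" "K \<noteq> {}"
  obtains a b where "a \<in> K" "b \<in> K" "collinear {p, a, b}" "dist a b = chord_diam K p"
proof -
  obtain L where L: "L \<in> lines_through p" "chord_diam K p = diameter (L \<inter> K)"
    using chord_diam_attained[OF K(1)] by blast
  show thesis
  proof (cases "L \<inter> K = {}")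
    case True
    \<comment> \<open>The best line misses \<open>K\<close>, so the value is
      \<open>diameter {} = 0\<close>, realised by a degenerate chord.\<close>
    obtain k where "k \<in> K" using K(2) by blast
    then show thesis using that[of k k] True L(2) by (simp add: insert_commute)
  next
    case False
    have aff: "affine L" "p \<in> L" "collinear L"
      using L(1) by (simp_all add: lines_through_def collinear_aff_dim)
    have "compact (L \<inter> K)" using K(1) aff(1) by (simp add: closed_Int_compact affine_closed)
    then obtain a b where ab: "a \<in> L \<inter> K" "b \<in> L \<inter> K" "dist a b = diameter (L \<inter> K)"
      using False diameter_compact_attained by blast
    moreover have "collinear {p, a, b}"
      using ab aff by (auto intro: collinear_subset)
    ultimately show thesis using that L(2) by auto
  qed
qed

lemma closed_chord_diam_ge:
  fixes K :: "'a::euclidean_space set"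
  assumes K: "compact K" "K \<noteq> {}"
  shows "closed {p. c \<le> chord_diam K p}"
proof -
  let ?T = "{z. collinear {snd z, fst (fst z), snd (fst z) :: 'a}}
    \<inter> {z. c \<le> dist (fst (fst z)) (snd (fst z))}"
  \<comment> \<open>Equality in Cauchy-Schwarz turns collinearity into an equation between
    continuous functions, hence a closed condition.\<close>
  have "closed ?T"
    unfolding collinear_3_diff[of "snd _"] norm_cauchy_schwarz_equal[symmetric]
    by (intro closed_Int closed_Collect_eq closed_Collect_le continuous_intros)
  then have "closed {p. \<exists>z. z \<in> K \<times> K \<and> (z, p) \<in> ?T}"
    by (intro closed_compact_projection compact_Times K)
  moreover have "{p. \<exists>z. z \<in> K \<times> K \<and> (z, p) \<in> ?T} = {p. c \<le> chord_diam K p}"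
  proof (intro equalityI subsetI CollectI; elim CollectE)
    fix p assume "\<exists>z. z \<in> K \<times> K \<and> (z, p) \<in> ?T"
    then obtain a b where "a \<in> K" "b \<in> K" "collinear {p, a, b}" "c \<le> dist a b" by auto
    then show "c \<le> chord_diam K p" using dist_le_chord_diam[OF K(1)] by (meson order_trans)
  next
    fix p assume "c \<le> chord_diam K p"
    moreover obtain a b where "a \<in> K" "b \<in> K" "collinear {p, a, b}" "dist a b = chord_diam K p"
      using chord_diam_endpoints[OF K] by blast
    ultimately show "\<exists>z. z \<in> K \<times> K \<and> (z, p) \<in> ?T" by (intro exI[of _ "(a, b)"]) auto
  qed
  ultimately show ?thesis by simp
qed

lemma eventually_chord_diam_less:
  fixes K :: "'a::euclidean_space set"
  assumes "compact K" "K \<noteq> {}" "chord_diam K p < c"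
  shows "eventually (\<lambda>q. chord_diam K q < c) (at p)"
proof -
  have "open (- {q. c \<le> chord_diam K q})"
    using closed_chord_diam_ge[OF assms(1,2)] by (simp add: open_closed)
  then have "eventually (\<lambda>q. q \<in> - {q. c \<le> chord_diam K q}) (at p)"
    using assms(3) by (intro eventually_at_topological[THEN iffD2]) auto
  then show ?thesis by eventually_elim auto
qed

lemma convex_combination_in_interior:
  fixes K :: "'a::euclidean_space set"
  assumes "convex K" "w \<in> interior K" "x \<in> K" "0 < s" "s \<le> 1"
  shows "(1 - s) *\<^sub>R x + s *\<^sub>R w \<in> interior K"
  using mem_interior_convex_shrink[OF assms] by (simp add: algebra_simps)

text \<open>Homotheties centred at \<open>p\<close> preserve lines through \<open>p\<close>. With
  \<open>p\<close> interior, a ratio in (0,1) carries \<open>K\<close> into its interior, and a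
  ratio near 1 costs little length.\<close>

lemma interior_chord_approx_inside:
  fixes K :: "'a::euclidean_space set"
  assumes K: "convex K" and p: "p \<in> interior K"
    and ab: "a \<in> K" "b \<in> K" "collinear {p, a, b}" and c: "c < dist a b"
  obtains a' b' where "a' \<in> interior K" "b' \<in> interior K" "collinear {p, a', b'}" "c < dist a' b'"
proof -
  define f where "f x s = (1 - s) *\<^sub>R x + s *\<^sub>R p" for x s
  have "((\<lambda>s. dist (f a s) (f b s)) \<longlongrightarrow> dist (f a 0) (f b 0)) (at_right 0)"
    unfolding f_def by (intro tendsto_intros)
  then have "eventually (\<lambda>s. c < dist (f a s) (f b s)) (at_right 0)"
    using c by (intro order_tendstoD) (auto simp: f_def)
  moreover have "eventually (\<lambda>s. s \<in> {0<..<1}) (at_right (0::real))"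
    by (rule eventually_at_right_real) simp
  ultimately have "eventually (\<lambda>s. c < dist (f a s) (f b s) \<and> s \<in> {0<..<1}) (at_right 0)"
    by (rule eventually_conj)
  then obtain s where s: "c < dist (f a s) (f b s)" "0 < s" "s < 1"
    using eventually_happens'[OF trivial_limit_at_right_real] by fastforce
  have "f a s - p = (1 - s) *\<^sub>R (a - p)" "f b s - p = (1 - s) *\<^sub>R (b - p)"
    by (simp_all add: f_def algebra_simps)
  then have "collinear {p, f a s, f b s}"
    using ab(3) by (simp add: collinear_3_diff[of p] collinear_scaleR_iff)
  then show thesis
    using that[of "f a s" "f b s"] s convex_combination_in_interior[OF K p] ab by (simp add: f_def)
qed

text \<open>Contraction towards \<open>p\<close> could leave \<open>K\<close>, so the endpoints move
  towards an interior point \<open>w\<close>. Equal speeds would in general break collinearity with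
  \<open>p\<close>.\<close>

lemma interior_chord_approx_outside:
  fixes K :: "'a::euclidean_space set"
  assumes K: "convex K" "interior K \<noteq> {}" and p: "p \<notin> K"
    and ab: "a \<in> K" "b \<in> K" "collinear {p, a, b}" and c: "c < dist a b"
  obtains a' b' where "a' \<in> interior K" "b' \<in> interior K" "collinear {p, a', b'}" "c < dist a' b'"
proof -
  obtain w where w: "w \<in> interior K" using K(2) by blast
  have "p \<noteq> b" "p \<noteq> a" using p ab by auto
  have "collinear {0, b - p, a - p}"
    using ab(3) unfolding collinear_3_diff[of p] by (simp add: insert_commute)
  then obtain k where k: "a - p = k *\<^sub>R (b - p)"
    using \<open>p \<noteq> b\<close> \<open>p \<noteq> a\<close> by (auto simp: collinear_lemma)
  \<comment> \<open>For \<open>k \<le> 0\<close> the point \<open>p\<close> would lie on the segment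
    from \<open>a\<close> to \<open>b\<close>, hence in \<open>K\<close> by convexity.\<close>
  have "k > 0"
  proof (rule ccontr)
    assume "\<not> k > 0"
    then have "1 - k > 0" by simp
    have "(1 - k) *\<^sub>R p = a + (- k) *\<^sub>R b" using k by (simp add: algebra_simps)
    then have "p = inverse (1 - k) *\<^sub>R (a + (- k) *\<^sub>R b)"
      using \<open>1 - k > 0\<close> by (metis less_irrefl scaleR_one scaleR_scaleR left_inverse)
    then have "p = (1 / (1 - k)) *\<^sub>R a + (- k / (1 - k)) *\<^sub>R b"
      unfolding scaleR_add_right scaleR_scaleR by (simp only: divide_inverse mult.commute mult_1)
    moreover have "(1 / (1 - k)) *\<^sub>R a + (- k / (1 - k)) *\<^sub>R b \<in> K"
      using \<open>1 - k > 0\<close> \<open>\<not> k > 0\<close>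
      by (intro convexD[OF K(1)] ab) (auto simp: field_simps)
    ultimately show False using p by simp
  qed
  \<comment> \<open>Chosen so that the endpoint \<open>f a (\<sigma> s)\<close> is collinear with \<open>p\<close> and \<open>f b s\<close>.\<close>
  define \<sigma> where "\<sigma> s = k * s / (1 - s + k * s)" for s
  define f where "f x s = (1 - s) *\<^sub>R x + s *\<^sub>R w" for x s
  have "((\<lambda>s. dist (f a (\<sigma> s)) (f b s)) \<longlongrightarrow> dist (f a (\<sigma> 0)) (f b 0)) (at_right 0)"
    unfolding f_def \<sigma>_def by (intro tendsto_intros) simp_all
  then have "eventually (\<lambda>s. c < dist (f a (\<sigma> s)) (f b s)) (at_right 0)"
    using c by (intro order_tendstoD) (auto simp: f_def \<sigma>_def)
  moreover have "eventually (\<lambda>s. s \<in> {0<..<1}) (at_right (0::real))"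
    by (rule eventually_at_right_real) simp
  ultimately have "eventually (\<lambda>s. c < dist (f a (\<sigma> s)) (f b s) \<and> s \<in> {0<..<1}) (at_right 0)"
    by (rule eventually_conj)
  then obtain s where s: "c < dist (f a (\<sigma> s)) (f b s)" "0 < s" "s < 1"
    using eventually_happens'[OF trivial_limit_at_right_real] by fastforce
  let ?D = "1 - s + k * s"
  have D: "?D > 0" using s \<open>k > 0\<close> by (intro add_pos_pos) auto
  have \<sigma>: "0 < \<sigma> s" "\<sigma> s \<le> 1" "1 - \<sigma> s = (1 - s) / ?D"
    using D s \<open>k > 0\<close> by (auto simp: \<sigma>_def field_simps)
  have fb: "f b s - p = (1 - s) *\<^sub>R (b - p) + s *\<^sub>R (w - p)"
    by (simp add: f_def algebra_simps)
  have "f a (\<sigma> s) - p = (1 - \<sigma> s) *\<^sub>R (a - p) + \<sigma> s *\<^sub>R (w - p)"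
    by (simp add: f_def algebra_simps)
  \<comment> \<open>After \<open>a - p = k *\<^sub>R (b - p)\<close> is inserted, the weights of
    \<open>b - p\<close> and \<open>w - p\<close> are \<open>k * (1 - \<sigma> s)\<close> and
    \<open>\<sigma> s\<close>. Requiring the ratio \<open>1 - s\<close> to \<open>s\<close>, as in
    \<open>f b s - p\<close>, forces the formula for \<open>\<sigma>\<close>.\<close>
  also have "\<dots> = (k / ?D) *\<^sub>R (f b s - p)"
    unfolding k \<sigma>(3) fb by (simp add: \<sigma>_def scaleR_add_right mult.commute)
  finally have "collinear {0, f b s - p, f a (\<sigma> s) - p}"
    by (auto simp: collinear_lemma)
  then have "collinear {p, f a (\<sigma> s), f b s}"
    by (simp add: collinear_3_diff[of p] insert_commute)
  moreover have "f a (\<sigma> s) \<in> interior K" "f b s \<in> interior K"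
    using s \<sigma>(1,2) ab unfolding f_def
    by (auto intro!: convex_combination_in_interior[OF K(1) w])
  ultimately show thesis using that s(1) by blast
qed

text \<open>Boundary points are excluded because the bound may fail there: just outside the midpoint
  of a longest side of a triangle the value drops.\<close>

lemma eventually_chord_diam_greater:
  fixes K :: "'a::euclidean_space set"
  assumes K: "convex_body K" and p: "p \<notin> K - interior K" and c: "c < chord_diam K p"
  shows "eventually (\<lambda>q. c < chord_diam K q) (at p)"
proof -
  have Kc: "compact K" "convex K" "interior K \<noteq> {}" "K \<noteq> {}"
    using K interior_subset by (auto simp: convex_body_def)
  obtain a b where ab: "a \<in> K" "b \<in> K" "collinear {p, a, b}" "c < dist a b"
    using chord_diam_endpoints[OF Kc(1,4)] c by metis
  obtain a' b' where ab': "a' \<in> interior K" "b' \<in> interior K" "collinear {p, a', b'}" "c < dist a' b'"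
  proof (cases "p \<in> K")
    case True
    then have "p \<in> interior K" using p by simp
    then show ?thesis using interior_chord_approx_inside[OF Kc(2) _ ab] that by blast
  next
    case False
    then show ?thesis using interior_chord_approx_outside[OF Kc(2,3) _ ab] that by blast
  qed
  have ev: "eventually (\<lambda>q. x + (q - p) \<in> interior K) (at p)" if x: "x \<in> interior K" for x
  proof -
    have "((\<lambda>q. x + (q - p)) \<longlongrightarrow> x + (p - p)) (at p)" by (intro tendsto_intros)
    then show ?thesis using x by (intro topological_tendstoD) auto
  qed
  show ?thesis
    using ev[OF ab'(1)] ev[OF ab'(2)]
  proof eventually_elim
    case (elim q)
    \<comment> \<open>Translation by \<open>q - p\<close> takes \<open>p\<close> to \<open>q\<close>
      and preserves collinearity and length.\<close>
    have "collinear {q, a' + (q - p), b' + (q - p)}"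
      using ab'(3) by (simp add: collinear_3_diff[of q] collinear_3_diff[of p])
    then have "dist (a' + (q - p)) (b' + (q - p)) \<le> chord_diam K q"
      using elim interior_subset by (intro dist_le_chord_diam Kc) auto
    then show ?case using ab'(4) by simp
  qed
qed

theorem proposition6:
  fixes K :: "(real ^ 'n) set"
  assumes "CARD('n) \<ge> 2"
    and "convex_body K"
  shows "upper_semicontinuous_on UNIV (chord_diam K)
    \<and> continuous_on (interior K) (chord_diam K)
    \<and> continuous_on (- K) (chord_diam K)"
proof -
  have K: "compact K" "K \<noteq> {}"
    using assms(2) interior_subset by (auto simp: convex_body_def)
  \<comment> \<open>Both \<open>interior K\<close> and \<open>- K\<close> avoid
    \<open>K - interior K\<close>, so one pointwise argument covers them.\<close>
  have "isCont (chord_diam K) p" if "p \<notin> K - interior K" for p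
    unfolding isCont_def
    using eventually_chord_diam_greater[OF assms(2) that] eventually_chord_diam_less[OF K]
    by (intro order_tendstoI)
  then have "continuous_on (interior K) (chord_diam K)" "continuous_on (- K) (chord_diam K)"
    by (auto intro: continuous_at_imp_continuous_on)
  moreover have "upper_semicontinuous_on UNIV (chord_diam K)"
    using eventually_chord_diam_less[OF K] by (simp add: upper_semicontinuous_on_def)
  ultimately show ?thesis by blast
qed

end
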